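(* Let $k\ge 0$ and let $\delta t_k>0$ be an arbitrary time step. Let $\mathbf n^k=[n_1^k,\dots,n_M^k]^T$, $\mathbf u^k$, $H^k\in\mathbb R$ be given, and suppose that $\mathbf n^{k+1}=[n_1^{k+1},\dots,n_M^{k+1}]^T$, $\mathbf u^{k+1}$, $H^{k+1}\in\mathbb R$ satisfy the following time-discrete scheme in $\Omega$ (with the setting, boundary conventions and standing assumptions of the context). (i) Discrete chemical potentials and scalar auxiliary variable: for $1\le i\le M$, $$\mu_i^{k+1}=\frac{H^{k+1}+H^k}{2\sqrt{F_b(\mathbf n^k)+\sum_{j=1}^M C_{T,j}N_j^t}}\,\mu_i^b(\mathbf n^k)-\sum_{j=1}^M\nabla\cdot\left(c_{ij}\nabla n_j^{k+1}\right),$$ $$\frac{H^{k+1}-H^k}{\delta t_k}=\sum_{i=1}^M\int_\Omega\frac{\mu_i^b(\mathbf n^k)}{2\sqrt{F_b(\mathbf n^k)+\sum_{j=1}^M C_{T,j}N_j^t}}\;\frac{n_i^{k+1}-n_i^k}{\delta t_k}\,d\mathbf x .$$ (ii) Intermediate velocity: $$\mathbf u_\star^k=\mathbf u^k-\frac{\delta t_k}{\rho^k}\sum_{i=1}^M n_i^k\nabla\mu_i^{k+1}.$$ (iii) Mass balance: for $1\le i\le M$, $$\frac{n_i^{k+1}-n_i^k}{\delta t_k}+\nabla\cdot(n_i^k\mathbf u_\star^k)+\nabla\cdot\mathbf J_i^{k+1}=0,\qquad \mathbf J_i^{k+1}=-\sum_{j=1}^M\mathcal M_{ij}^k\nabla\mu_j^{k+1}.$$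 (iv) Momentum balance: $$\rho^k\frac{\mathbf u^{k+1}-\mathbf u^k}{\delta t_k}+\rho^k\mathbf u_\star^k\cdot\nabla\mathbf u^{k+1}+\sum_{i=1}^M M_{w,i}\mathbf J_i^{k+1}\cdot\nabla\mathbf u^{k+1}=-\sum_{i=1}^M n_i^k\nabla\mu_i^{k+1}+\nabla\left(\lambda^k\nabla\cdot\mathbf u^{k+1}\right)+\nabla\cdot\left(\eta^k\left(\nabla\mathbf u^{k+1}+(\nabla\mathbf u^{k+1})^T\right)\right).$$ For $m\in\{k,k+1\}$ define the discrete kinetic energy and the modified Helmholtz free energy by $$E^m=\frac12\int_\Omega\rho^m|\mathbf u^m|^2\,d\mathbf x,\qquad \mathcal F^m=|H^m|^2+\frac12\int_\Omega\sum_{i,j=1}^M c_{ij}\nabla n_i^m\cdot\nabla n_j^m\,d\mathbf x-\sum_{i=1}^M C_{T,i}N_i^t .$$ Then the modified total energy is dissipated: $$E^{k+1}+\mathcal F^{k+1}\le E^k+\mathcal F^k .$$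
   Context: **Domain and boundary convention.** $\Omega\subset\mathbb R^d$ ($1\le d\le 3$) is an open, bounded, connected domain with sufficiently smooth boundary. All fields are sufficiently smooth, and the boundary conditions (e.g. homogeneous Neumann-type/no-flux conditions or periodic conditions) are such that all boundary terms vanish whenever integration by parts is performed in the terms of the scheme; that is, the divergence terms $\nabla\cdot(c_{ij}\nabla n_j)$, the divergences of the convective fluxes and of the diffusion fluxes $\mathbf J_i$, and the viscous terms may be integrated by parts over $\Omega$ against scalar (including constant) or velocity fields of the scheme without boundary contributions. **Unknowns.** $M\ge1$ is the number of chemical components. $n_i^m:\Omega\to\mathbb R$ is the molar density of component $i$ at time step $m$; $\mathbf u^m:\Omega\to\mathbb R^d$ is the velocity; $H^m\in\mathbb R$ is a scalar auxiliary variable, approximating $H(t)=\sqrt{F_b+\sum_i C_{T,i}N_i^t}$ at time $t_m$. $M_{w,i}>0$ is the molar weight of component $i$ and $\rho^m=\sum_{i=1}^M M_{w,i}n_i^m$ is the overall mass density; $\rho^k>0$. For a vector field $\mathbf v$, $\mathbf v\cdot\nabla\mathbf u$ means $(\mathbf v\cdot\nabla)\mathbf u$. **Free energy.** $F_b(\mathbf n)=\int_\Omega f_b(\mathbf n)\,d\mathbf x$ and $\mu_i^b(\mathbf n)=\partial f_b(\mathbf n)/\partial n_i$, where $f_b$ is the Peng–Robinson bulk Helmholtz free energy density at fixed temperature $T>0$: with $n=\sum_i n_i$, $$f_b(\mathbf n)=RT\sum_{i=1}^M n_i(\ln n_i-1)-nRT\ln(1-bn)+\frac{a\,n}{2\sqrt2\,b}\ln\left(\frac{1+(1-\sqrt2)bn}{1+(1+\sqrt2)bn}\right),$$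 $$a=\sum_{i,j=1}^M y_iy_j(a_ia_j)^{1/2}(1-k_{ij}),\quad b=\sum_{i=1}^M y_ib_i,\quad y_i=n_i/n,$$ where $R>0$ is the universal gas constant, $k_{ij}$ are constant binary interaction coefficients, and $a_i=0.45724\frac{R^2T_{c_i}^2}{P_{c_i}}[1+m_i(1-\sqrt{T/T_{c_i}})]^2$, $b_i=0.07780\frac{RT_{c_i}}{P_{c_i}}$ are constants determined by the critical temperature $T_{c_i}$ and critical pressure $P_{c_i}$ of component $i$ and by a constant $m_i$ given by the acentric factor $\omega_i$ ($m_i=0.37464+1.54226\omega_i-0.26992\omega_i^2$ if $\omega_i\le0.49$; $m_i=0.379642+1.485030\omega_i-0.164423\omega_i^2+0.016666\omega_i^3$ if $\omega_i>0.49$). The density vector $\mathbf n^k$ takes values in the domain of $f_b$. **Coefficients.** $(c_{ij})_{i,j=1}^M$ is a constant, symmetric, positive definite or positive semidefinite matrix (influence parameters, depending only on temperature). $C_{T,i}\ge0$ are constants independent of the molar densities. $N_i^t=\int_\Omega n_i^k\,d\mathbf x$ is the total number of moles of component $i$, which does not depend on the time step $k$ (mass is conserved by the scheme under the boundary convention). The constants $C_{T,i}$ are chosen so that $F_b(\mathbf n^k)+\sum_jC_{T,j}N_j^t>0$, so that the square root in the denominators is nonzero. The mobility matrix $(\mathcal M_{ij}^k)_{i,j=1}^M$, evaluated from $\mathbf n^k$ (so in general depending on $\mathbf x$), is symmetric and at least positive semidefinite at each point. $\eta^k>0$ (shear viscosity) and $\lambda^k=\xi^k-\frac23\eta^k>0$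 (with $\xi^k$ the volumetric viscosity) are the viscosity coefficients at step $k$. *)

theory Defs
  imports "HOL-Analysis.Analysis"
begin

text \<open>Lipschitz boundary: near each boundary point the domain is, in a suitable direction \<open>\<nu>\<close>,
  the set below a Lipschitz graph. The graph function \<open>\<gamma>\<close> is defined on the whole space but does not
  depend on the \<open>\<nu>\<close>-coordinate. This is the weakest usual reading of a boundary that is smooth enough
  for the divergence theorem; it covers smooth domains as well as the boxes on which periodic
  boundary conditions are posed.\<close>

definition lipschitz_boundary :: "'a::euclidean_space set \<Rightarrow> bool" where
  "lipschitz_boundary \<Omega> \<longleftrightarrow>
     (\<forall>p\<in>frontier \<Omega>. \<exists>r>0. \<exists>\<nu> L. \<exists>\<gamma>::'a \<Rightarrow> real.
        norm \<nu> = 1 \<and> L-lipschitz_on UNIV \<gamma> \<and> (\<forall>x t. \<gamma> (x + t *\<^sub>R \<nu>) = \<gamma> x) \<and>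
        \<Omega> \<inter> ball p r = {x \<in> ball p r. x \<bullet> \<nu> < \<gamma> x})"

definition admissible_domain :: "(real^'d::finite) set \<Rightarrow> bool" where
  "admissible_domain \<Omega> \<longleftrightarrow>
     open \<Omega> \<and> bounded \<Omega> \<and> connected \<Omega> \<and> \<Omega> \<noteq> {} \<and> lipschitz_boundary \<Omega>"

text \<open>\<open>Ck_bar k \<Omega> f\<close> renders \<open>f \<in> C\<^sup>k\<close> of the closure of \<open>\<Omega>\<close>, for \<open>\<Omega>\<close> open and bounded: all partial
  derivatives of order at most \<open>k\<close> exist in \<open>\<Omega>\<close> and are uniformly continuous there, i.e. extend
  continuously to the closure. Values of \<open>f\<close> outside \<open>\<Omega>\<close> are irrelevant.\<close>

primrec Ck_bar ::
  "nat \<Rightarrow> 'a::euclidean_space set \<Rightarrow> ('a \<Rightarrow> 'b::real_normed_vector) \<Rightarrow> bool" where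
  "Ck_bar 0 \<Omega> f \<longleftrightarrow> uniformly_continuous_on \<Omega> f"
| "Ck_bar (Suc k) \<Omega> f \<longleftrightarrow>
     uniformly_continuous_on \<Omega> f \<and> f differentiable_on \<Omega> \<and>
     (\<forall>e\<in>Basis. Ck_bar k \<Omega> (\<lambda>x. frechet_derivative f (at x) e))"

definition grad :: "(real^'d::finite \<Rightarrow> real) \<Rightarrow> real^'d \<Rightarrow> real^'d" where
  "grad f x = (\<chi> j. frechet_derivative f (at x) (axis j 1))"

definition divergence :: "(real^'d::finite \<Rightarrow> real^'d) \<Rightarrow> real^'d \<Rightarrow> real" where
  "divergence F x = (\<Sum>j\<in>UNIV. frechet_derivative F (at x) (axis j 1) $ j)"

text \<open>Row-wise. Below \<open>\<nabla>u\<close> is the library's \<^const>\<open>jacobian\<close>, with entries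
  \<open>(\<nabla>u)\<^sub>i\<^sub>j = \<partial>\<^sub>j u\<^sub>i\<close>, so that \<open>(v \<cdot> \<nabla>) u = \<nabla>u *v v\<close>.\<close>

definition tensor_divergence :: "(real^'d::finite \<Rightarrow> real^'d^'d) \<Rightarrow> real^'d \<Rightarrow> real^'d" where
  "tensor_divergence S x = (\<chi> i. divergence (\<lambda>y. S y $ i) x)"

definition advect :: "real^'d::finite \<Rightarrow> (real^'d \<Rightarrow> real^'d) \<Rightarrow> real^'d \<Rightarrow> real^'d" where
  "advect v u x = jacobian u (at x) *v v"

definition flux_by_parts ::
  "(real^'d::finite) set \<Rightarrow> (real^'d \<Rightarrow> real^'d) \<Rightarrow> (real^'d \<Rightarrow> real) \<Rightarrow> bool" where
  "flux_by_parts \<Omega> F \<phi> \<longleftrightarrow>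
     (LBINT x:\<Omega>. divergence F x * \<phi> x) = - (LBINT x:\<Omega>. F x \<bullet> grad \<phi> x)"

definition grad_by_parts ::
  "(real^'d::finite) set \<Rightarrow> (real^'d \<Rightarrow> real) \<Rightarrow> (real^'d \<Rightarrow> real^'d) \<Rightarrow> bool" where
  "grad_by_parts \<Omega> q v \<longleftrightarrow>
     (LBINT x:\<Omega>. grad q x \<bullet> v x) = - (LBINT x:\<Omega>. q x * divergence v x)"

text \<open>The inner product of the library on \<open>real^'d^'d\<close> is the Frobenius product.\<close>

definition tensor_by_parts ::
  "(real^'d::finite) set \<Rightarrow> (real^'d \<Rightarrow> real^'d^'d) \<Rightarrow> (real^'d \<Rightarrow> real^'d) \<Rightarrow> bool" where
  "tensor_by_parts \<Omega> S v \<longleftrightarrow>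
     (LBINT x:\<Omega>. tensor_divergence S x \<bullet> v x) = - (LBINT x:\<Omega>. S x \<bullet> jacobian v (at x))"

record 'm mixture =
  gas_const :: real
  temperature :: real
  crit_temp :: "'m \<Rightarrow> real"
  crit_pres :: "'m \<Rightarrow> real"
  acentric :: "'m \<Rightarrow> real"
  interaction :: "'m \<Rightarrow> 'm \<Rightarrow> real"

definition admissible_mixture :: "'m mixture \<Rightarrow> bool" where
  "admissible_mixture p \<longleftrightarrow> gas_const p > 0 \<and> temperature p > 0 \<and>
     (\<forall>i. crit_temp p i > 0 \<and> crit_pres p i > 0)"

definition acentric_coeff :: "real \<Rightarrow> real" where
  "acentric_coeff w =
     (if w \<le> 0.49 then 0.37464 + 1.54226 * w - 0.26992 * w^2
      else 0.379642 + 1.485030 * w - 0.164423 * w^2 + 0.016666 * w^3)"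

definition pr_ai :: "'m mixture \<Rightarrow> 'm \<Rightarrow> real" where
  "pr_ai p i = 0.45724 * ((gas_const p)^2 * (crit_temp p i)^2 / crit_pres p i) *
     (1 + acentric_coeff (acentric p i) * (1 - sqrt (temperature p / crit_temp p i)))^2"

definition pr_bi :: "'m mixture \<Rightarrow> 'm \<Rightarrow> real" where
  "pr_bi p i = 0.07780 * (gas_const p * crit_temp p i / crit_pres p i)"

definition mole_fraction :: "('m::finite \<Rightarrow> real) \<Rightarrow> 'm \<Rightarrow> real" where
  "mole_fraction v i = v i / (\<Sum>j\<in>UNIV. v j)"

definition pr_a :: "'m::finite mixture \<Rightarrow> ('m \<Rightarrow> real) \<Rightarrow> real" where
  "pr_a p v = (\<Sum>i\<in>UNIV. \<Sum>j\<in>UNIV. mole_fraction v i * mole_fraction v j *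
     sqrt (pr_ai p i * pr_ai p j) * (1 - interaction p i j))"

definition pr_b :: "'m::finite mixture \<Rightarrow> ('m \<Rightarrow> real) \<Rightarrow> real" where
  "pr_b p v = (\<Sum>i\<in>UNIV. mole_fraction v i * pr_bi p i)"

definition bulk_density :: "'m::finite mixture \<Rightarrow> ('m \<Rightarrow> real) \<Rightarrow> real" where
  "bulk_density p v =
     (let R = gas_const p; T = temperature p; n = (\<Sum>i\<in>UNIV. v i); a = pr_a p v; b = pr_b p v
      in R * T * (\<Sum>i\<in>UNIV. v i * (ln (v i) - 1))
         - n * R * T * ln (1 - b * n)
         + a * n / (2 * sqrt 2 * b) *
           ln ((1 + (1 - sqrt 2) * b * n) / (1 + (1 + sqrt 2) * b * n)))"

text \<open>For positive molar densities, the argument of the last logarithm is positive as soon as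
  \<open>b n < 1\<close>.\<close>

definition bulk_domain :: "'m::finite mixture \<Rightarrow> ('m \<Rightarrow> real) set" where
  "bulk_domain p = {v. (\<forall>i. v i > 0) \<and> pr_b p v * (\<Sum>i\<in>UNIV. v i) < 1}"

definition bulk_potential :: "'m::finite mixture \<Rightarrow> 'm \<Rightarrow> ('m \<Rightarrow> real) \<Rightarrow> real" where
  "bulk_potential p i v = deriv (\<lambda>s. bulk_density p (v(i := s))) (v i)"

definition bulk_energy ::
  "'m::finite mixture \<Rightarrow> (real^'d::finite) set \<Rightarrow> ('m \<Rightarrow> real^'d \<Rightarrow> real) \<Rightarrow> real" where
  "bulk_energy p \<Omega> n = (LBINT x:\<Omega>. bulk_density p (\<lambda>i. n i x))"

definition positive_semidefinite :: "real^'m^'m::finite \<Rightarrow> bool" where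
  "positive_semidefinite A \<longleftrightarrow> (\<forall>v. 0 \<le> v \<bullet> (A *v v))"

definition total_moles :: "(real^'d::finite) set \<Rightarrow> ('m \<Rightarrow> real^'d \<Rightarrow> real) \<Rightarrow> 'm \<Rightarrow> real" where
  "total_moles \<Omega> n i = (LBINT x:\<Omega>. n i x)"

definition mass_density ::
  "('m::finite \<Rightarrow> real) \<Rightarrow> ('m \<Rightarrow> real^'d::finite \<Rightarrow> real) \<Rightarrow> real^'d \<Rightarrow> real" where
  "mass_density Mw n x = (\<Sum>i\<in>UNIV. Mw i * n i x)"

definition diffusion_flux ::
  "(real^'d \<Rightarrow> real^'m^'m) \<Rightarrow> ('m::finite \<Rightarrow> real^'d::finite \<Rightarrow> real) \<Rightarrow> 'm \<Rightarrow> real^'d \<Rightarrow> real^'d" where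
  "diffusion_flux Mob \<mu> i x = - (\<Sum>j\<in>UNIV. (Mob x $ i $ j) *\<^sub>R grad (\<mu> j) x)"

definition viscous_stress ::
  "(real^'d \<Rightarrow> real) \<Rightarrow> (real^'d::finite \<Rightarrow> real^'d) \<Rightarrow> real^'d \<Rightarrow> real^'d^'d" where
  "viscous_stress \<eta> u x = \<eta> x *\<^sub>R (jacobian u (at x) + transpose (jacobian u (at x)))"

definition kinetic_energy ::
  "(real^'d::finite) set \<Rightarrow> ('m::finite \<Rightarrow> real) \<Rightarrow> ('m \<Rightarrow> real^'d \<Rightarrow> real) \<Rightarrow>
     (real^'d \<Rightarrow> real^'d) \<Rightarrow> real" where
  "kinetic_energy \<Omega> Mw n u = 1/2 * (LBINT x:\<Omega>. mass_density Mw n x * (norm (u x))^2)"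

definition modified_free_energy ::
  "(real^'d::finite) set \<Rightarrow> real^'m^'m \<Rightarrow> ('m::finite \<Rightarrow> real) \<Rightarrow> ('m \<Rightarrow> real) \<Rightarrow>
     ('m \<Rightarrow> real^'d \<Rightarrow> real) \<Rightarrow> real \<Rightarrow> real" where
  "modified_free_energy \<Omega> c CT Nt n H =
     \<bar>H\<bar>^2 + 1/2 * (LBINT x:\<Omega>. \<Sum>i\<in>UNIV. \<Sum>j\<in>UNIV. c $ i $ j * (grad (n i) x \<bullet> grad (n j) x))
     - (\<Sum>i\<in>UNIV. CT i * Nt i)"

text \<open>Scalar fields against which the fluxes are tested: constants, molar densities at both levels,
  the new chemical potentials, and the squared speed \<open>|u|\<^sup>2\<close> that arises when the convective terms
  are tested with the new velocity.\<close>

definition scalar_tests ::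
  "('m \<Rightarrow> real^'d::finite \<Rightarrow> real) \<Rightarrow> ('m \<Rightarrow> real^'d \<Rightarrow> real) \<Rightarrow> ('m \<Rightarrow> real^'d \<Rightarrow> real) \<Rightarrow>
     (real^'d \<Rightarrow> real^'d) \<Rightarrow> (real^'d \<Rightarrow> real) set" where
  "scalar_tests n n' \<mu> u =
     range (\<lambda>r x. r) \<union> range n \<union> range n' \<union> range \<mu> \<union> {\<lambda>x. (norm (u x))^2}"

end

theory Submission
  imports Defs
begin

text \<open>The auxiliary equation times \<open>H\<^sup>k\<^sup>+\<^sup>1 + H\<^sup>k\<close>, with the bulk potentials eliminated through the
  definition of \<open>\<mu>\<^sub>i\<close>, and the convexity of the gradient energy give
  \<open>F' - F \<le> \<Sum>\<^sub>i \<integral> \<mu>\<^sub>i (n\<^sub>i' - n\<^sub>i)\<close>. By the mass balance tested with \<open>\<mu>\<^sub>i\<close> and the semidefiniteness of the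
  mobility this is at most \<open>dt \<integral> u\<^sub>* \<bullet> G\<close> with \<open>G = \<Sum>\<^sub>i n\<^sub>i \<nabla>\<mu>\<^sub>i\<close>. Since \<open>dt G = \<rho> (u - u\<^sub>*)\<close>, polarization
  bounds it by \<open>1/2 \<integral> \<rho> (|u|\<^sup>2 - |u\<^sub>*|\<^sup>2)\<close>. The same substitution turns the momentum balance into one
  for \<open>\<rho> (u' - u\<^sub>*)\<close> without pressure term. Tested with \<open>u'\<close>, its convective terms equal
  \<open>1/2 \<integral> (\<rho>' - \<rho>) |u'|\<^sup>2 / dt\<close> by the mass balance tested with \<open>|u'|\<^sup>2\<close>, and the viscous terms dissipate;
  hence \<open>1/2 \<integral> \<rho>' |u'|\<^sup>2 \<le> 1/2 \<integral> \<rho> |u\<^sub>*|\<^sup>2\<close>. Every integrand is bounded and continuous on the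
  domain: for the divergences of \<open>J\<^sub>i\<close> and of the viscous stress, whose coefficients are not
  differentiated explicitly, this is read off the mass and momentum balances.\<close>

subsection \<open>Bounded continuous functions\<close>

text \<open>Working class for the integrands: on a bounded open set membership gives integrability,
  and sums and bounded bilinear products stay inside the class.\<close>

definition bounded_cont_on ::
  "'a::topological_space set \<Rightarrow> ('a \<Rightarrow> 'b::real_normed_vector) \<Rightarrow> bool" where
  "bounded_cont_on S f \<longleftrightarrow> continuous_on S f \<and> bounded (f ` S)"

lemma bounded_cont_on_const: "bounded_cont_on S (\<lambda>x. a)"
  unfolding bounded_cont_on_def by (auto intro: bounded_subset[of "{a}"])

text \<open>Only values on \<open>S\<close> count, so identities that hold merely inside the domain,
  such as the balance equations, transfer regularity.\<close>

lemma bounded_cont_on_cong: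
  assumes "\<And>x. x \<in> S \<Longrightarrow> f x = g x" shows "bounded_cont_on S f \<longleftrightarrow> bounded_cont_on S g"
proof -
  have "f ` S = g ` S" using assms by (rule image_cong[OF refl])
  then show ?thesis
    unfolding bounded_cont_on_def using assms by (simp cong: continuous_on_cong)
qed

lemma bounded_cont_on_add:
  assumes "bounded_cont_on S f" "bounded_cont_on S g"
  shows "bounded_cont_on S (\<lambda>x. f x + g x)"
  using assms unfolding bounded_cont_on_def
  by (auto intro: continuous_on_add bounded_plus_comp)

lemma bounded_cont_on_diff:
  assumes "bounded_cont_on S f" "bounded_cont_on S g"
  shows "bounded_cont_on S (\<lambda>x. f x - g x)"
  using assms unfolding bounded_cont_on_def
  by (auto intro: continuous_on_diff bounded_minus_comp)

lemma bounded_cont_on_sum: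
  assumes "\<And>i. i \<in> A \<Longrightarrow> bounded_cont_on S (f i)"
  shows "bounded_cont_on S (\<lambda>x. \<Sum>i\<in>A. f i x)"
proof (cases "finite A")
  case True
  then show ?thesis using assms
    by (induction A) (auto intro: bounded_cont_on_const bounded_cont_on_add)
qed (simp add: bounded_cont_on_const)

text \<open>Handles products, scalar multiples and inner products at once; boundedness comes from
  the operator bound \<open>K\<close> of the bilinear map.\<close>

lemma (in bounded_bilinear) bounded_cont_on_prod:
  assumes f: "bounded_cont_on S f" and g: "bounded_cont_on S g"
  shows "bounded_cont_on S (\<lambda>x. prod (f x) (g x))"
proof -
  obtain B C where B: "\<And>x. x \<in> S \<Longrightarrow> norm (f x) \<le> B" and C: "\<And>x. x \<in> S \<Longrightarrow> norm (g x) \<le> C"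
    using f g unfolding bounded_cont_on_def bounded_iff by auto
  obtain K where K: "0 \<le> K" "\<And>a b. norm (prod a b) \<le> norm a * norm b * K"
    using nonneg_bounded by blast
  have "norm (prod (f x) (g x)) \<le> B * C * K" if "x \<in> S" for x
  proof -
    \<comment> \<open>\<open>B\<close> is nonnegative because it bounds a norm at the point
      \<open>x\<close>.\<close>
    have "norm (f x) * norm (g x) \<le> B * C"
      using B[OF that] C[OF that] order_trans[OF norm_ge_zero B[OF that]] by (intro mult_mono) auto
    then have "norm (f x) * norm (g x) * K \<le> B * C * K"
      using K(1) by (rule mult_right_mono)
    then show ?thesis using K(2)[of "f x" "g x"] by linarith
  qed
  then have "bounded ((\<lambda>x. prod (f x) (g x)) ` S)" unfolding bounded_iff by auto
  then show ?thesis using f g unfolding bounded_cont_on_def by (simp add: continuous_on)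
qed

lemmas bounded_cont_on_mult = bounded_bilinear.bounded_cont_on_prod[OF bounded_bilinear_mult]
lemmas bounded_cont_on_scaleR = bounded_bilinear.bounded_cont_on_prod[OF bounded_bilinear_scaleR]
lemmas bounded_cont_on_inner = bounded_bilinear.bounded_cont_on_prod[OF bounded_bilinear_inner]

lemma bounded_cont_on_norm_power2:
  fixes f :: "'a::topological_space \<Rightarrow> 'b::real_inner"
  assumes "bounded_cont_on S f" shows "bounded_cont_on S (\<lambda>x. (norm (f x))^2)"
  unfolding power2_norm_eq_inner by (intro bounded_cont_on_inner assms)

lemmas bounded_cont_on_intros =
  bounded_cont_on_add bounded_cont_on_diff bounded_cont_on_sum bounded_cont_on_mult
  bounded_cont_on_scaleR bounded_cont_on_inner bounded_cont_on_norm_power2 bounded_cont_on_const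

text \<open>Continuity on an open set gives measurability, and a bounded set has finite Lebesgue
  measure.\<close>

lemma bounded_cont_on_integrable:
  fixes f :: "'a::euclidean_space \<Rightarrow> real"
  assumes S: "open S" "bounded S" and f: "bounded_cont_on S f"
  shows "set_integrable lborel S f"
proof -
  obtain B where B: "\<And>x. x \<in> S \<Longrightarrow> norm (f x) \<le> B"
    using f unfolding bounded_cont_on_def bounded_iff by auto
  have "S \<in> sets borel" using S(1) by (rule borel_open)
  then have m: "(\<lambda>x. indicator S x *\<^sub>R f x) \<in> borel_measurable lborel"
    using f borel_measurable_continuous_on_indicator[of S f] unfolding bounded_cont_on_def by simp
  \<comment> \<open>The rule wants an integrand measurable on the whole space, which
    \<open>f\<close> may fail to be; hence it is applied to \<open>f\<close> cut off by the
    indicator, and the doubled indicator collapses afterwards.\<close>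
  have "integrable lborel (\<lambda>x. indicator S x *\<^sub>R (indicator S x *\<^sub>R f x))"
    using \<open>S \<in> sets borel\<close> m emeasure_bounded_finite[OF S(2)] B
    by (intro integrableI_bounded_set_indicator[where B = B]) auto
  also have "(\<lambda>x. indicator S x *\<^sub>R (indicator S x *\<^sub>R f x)) = (\<lambda>x. indicator S x *\<^sub>R f x)"
    by (auto simp: indicator_def)
  finally show ?thesis unfolding set_integrable_def .
qed

lemma set_integral_sum:
  fixes f :: "'i \<Rightarrow> 'a \<Rightarrow> 'b::{banach, second_countable_topology}"
  assumes "\<And>i. i \<in> A \<Longrightarrow> set_integrable M S (f i)"
  shows "(LINT x:S|M. \<Sum>i\<in>A. f i x) = (\<Sum>i\<in>A. LINT x:S|M. f i x)"
  using assms unfolding set_integrable_def set_lebesgue_integral_def scaleR_sum_right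
  by (rule Bochner_Integration.integral_sum)

text \<open>A non-integrable function has integral 0 by convention, so the pointwise sign alone
  decides.\<close>

lemma set_integral_nonneg:
  fixes f :: "'a \<Rightarrow> real"
  assumes "\<And>x. x \<in> S \<Longrightarrow> 0 \<le> f x" shows "0 \<le> (LINT x:S|M. f x)"
  unfolding set_lebesgue_integral_def using assms
  by (intro Bochner_Integration.integral_nonneg) (simp add: indicator_def)

text \<open>A consequence of \<open>Ck_bar\<close> on bounded open sets, phrased with derivatives at
  points instead of within the set, so that the usual derivative rules apply directly.\<close>

definition C1_bounded ::
  "'a::euclidean_space set \<Rightarrow> ('a \<Rightarrow> 'b::real_normed_vector) \<Rightarrow> bool" where
  "C1_bounded S f \<longleftrightarrow> bounded_cont_on S f \<and> (\<forall>x\<in>S. f differentiable (at x)) \<and>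
     (\<forall>e\<in>Basis. bounded_cont_on S (\<lambda>x. frechet_derivative f (at x) e))"

lemma C1_boundedD:
  assumes "C1_bounded S f"
  shows "bounded_cont_on S f" "x \<in> S \<Longrightarrow> f differentiable (at x)"
    "x \<in> S \<Longrightarrow> (f has_derivative frechet_derivative f (at x)) (at x)"
    "e \<in> Basis \<Longrightarrow> bounded_cont_on S (\<lambda>x. frechet_derivative f (at x) e)"
  using assms unfolding C1_bounded_def frechet_derivative_works[symmetric] by blast+

lemma bounded_cont_on_Ck_bar:
  fixes f :: "'a::euclidean_space \<Rightarrow> 'b::euclidean_space"
  assumes "bounded S" "Ck_bar k S f" shows "bounded_cont_on S f"
proof -
  have "uniformly_continuous_on S f" using assms(2) by (cases k) auto
  then show ?thesis
    unfolding bounded_cont_on_def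
    using assms(1) by (simp add: uniformly_continuous_imp_continuous bounded_uniformly_continuous_image)
qed

text \<open>Openness of \<open>S\<close> turns differentiability within \<open>S\<close> into
  differentiability at each of its points.\<close>

lemma C1_bounded_Ck_bar:
  fixes f :: "'a::euclidean_space \<Rightarrow> 'b::euclidean_space"
  assumes "open S" "bounded S" "Ck_bar (Suc k) S f" shows "C1_bounded S f"
proof -
  have f: "f differentiable_on S" "\<forall>e\<in>Basis. Ck_bar k S (\<lambda>x. frechet_derivative f (at x) e)"
    using assms(3) unfolding Ck_bar.simps(2) by blast+
  show ?thesis
    unfolding C1_bounded_def
  proof (intro conjI ballI)
    show "bounded_cont_on S f" by (rule bounded_cont_on_Ck_bar[OF assms(2,3)])
    show "f differentiable (at x)" if "x \<in> S" for x
      using f(1) that at_within_open[OF that assms(1)] unfolding differentiable_on_def by force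
    show "bounded_cont_on S (\<lambda>x. frechet_derivative f (at x) e)" if "e \<in> Basis" for e
      by (rule bounded_cont_on_Ck_bar[OF assms(2) bspec[OF f(2) that]])
  qed
qed

lemma C1_bounded_frechet_derivative_Ck_bar:
  fixes f :: "'a::euclidean_space \<Rightarrow> 'b::euclidean_space"
  assumes "open S" "bounded S" "Ck_bar (Suc (Suc k)) S f" "e \<in> Basis"
  shows "C1_bounded S (\<lambda>x. frechet_derivative f (at x) e)"
proof -
  have "Ck_bar (Suc k) S (\<lambda>x. frechet_derivative f (at x) e)"
    using assms(3,4) Ck_bar.simps(2)[of "Suc k" S f] by blast
  then show ?thesis by (rule C1_bounded_Ck_bar[OF assms(1,2)])
qed

text \<open>Derivative rules supply a candidate \<open>D\<close>; uniqueness of the derivative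
  identifies it with \<open>frechet_derivative\<close>.\<close>

lemma C1_boundedI:
  assumes "bounded_cont_on S f" "\<And>x. x \<in> S \<Longrightarrow> (f has_derivative D x) (at x)"
    "\<And>e. e \<in> Basis \<Longrightarrow> bounded_cont_on S (\<lambda>x. D x e)"
  shows "C1_bounded S f"
proof -
  have eq: "frechet_derivative f (at x) = D x" if "x \<in> S" for x
    using frechet_derivative_at[OF assms(2)[OF that]] by simp
  have "bounded_cont_on S (\<lambda>x. frechet_derivative f (at x) e)" if "e \<in> Basis" for e
    using assms(3)[OF that] bounded_cont_on_cong[of S "\<lambda>x. frechet_derivative f (at x) e" "\<lambda>x. D x e"]
    by (simp add: eq)
  then show ?thesis
    unfolding C1_bounded_def using assms(1,2) by (auto simp: differentiable_def)
qed

lemma C1_bounded_const: "C1_bounded S (\<lambda>x. a)"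
  by (rule C1_boundedI[where D = "\<lambda>x h. 0"]) (auto intro: bounded_cont_on_const)

lemma C1_bounded_add:
  assumes "C1_bounded S f" "C1_bounded S g" shows "C1_bounded S (\<lambda>x. f x + g x)"
  by (rule C1_boundedI)
    (auto intro: bounded_cont_on_add has_derivative_add C1_boundedD[OF assms(1)] C1_boundedD[OF assms(2)])

lemma C1_bounded_sum:
  assumes "\<And>i. i \<in> A \<Longrightarrow> C1_bounded S (f i)"
  shows "C1_bounded S (\<lambda>x. \<Sum>i\<in>A. f i x)"
proof (cases "finite A")
  case True
  then show ?thesis using assms
    by (induction A) (auto intro: C1_bounded_const C1_bounded_add)
qed (simp add: C1_bounded_const)

lemma (in bounded_bilinear) C1_bounded_prod:
  assumes "C1_bounded S f" "C1_bounded S g" shows "C1_bounded S (\<lambda>x. prod (f x) (g x))"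
proof (rule C1_boundedI)
  show "((\<lambda>x. prod (f x) (g x)) has_derivative
      (\<lambda>h. prod (f x) (frechet_derivative g (at x) h) + prod (frechet_derivative f (at x) h) (g x)))
      (at x)" if "x \<in> S" for x
    using that by (intro FDERIV C1_boundedD(3)[OF assms(1)] C1_boundedD(3)[OF assms(2)])
qed (intro bounded_cont_on_add bounded_cont_on_prod C1_boundedD(1,4) assms; assumption)+

lemmas C1_bounded_mult = bounded_bilinear.C1_bounded_prod[OF bounded_bilinear_mult]
lemmas C1_bounded_scaleR = bounded_bilinear.C1_bounded_prod[OF bounded_bilinear_scaleR]
lemmas C1_bounded_inner = bounded_bilinear.C1_bounded_prod[OF bounded_bilinear_inner]

subsection \<open>Gradient, divergence and advection\<close>

text \<open>Writes the gradient as a finite sum of partial derivatives times constant vectors, the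
  form to which the closure rules for sums and products apply.\<close>

lemma grad_eq_sum: "grad f x = (\<Sum>j\<in>UNIV. frechet_derivative f (at x) (axis j 1) *\<^sub>R axis j 1)"
  by (simp add: grad_def vec_eq_iff axis_def if_distrib cong: if_cong)

lemma divergence_eq_sum:
  "divergence F x = (\<Sum>j\<in>UNIV. frechet_derivative F (at x) (axis j 1) \<bullet> axis j 1)"
  by (simp add: divergence_def inner_axis)

lemma bounded_cont_on_grad: "C1_bounded S f \<Longrightarrow> bounded_cont_on S (grad f)"
  unfolding grad_eq_sum[abs_def]
  by (intro bounded_cont_on_intros C1_boundedD(4)) (simp_all add: axis_in_Basis_iff)

lemma bounded_cont_on_divergence: "C1_bounded S F \<Longrightarrow> bounded_cont_on S (divergence F)"
  unfolding divergence_eq_sum[abs_def]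
  by (intro bounded_cont_on_intros C1_boundedD(4)) (simp_all add: axis_in_Basis_iff)

lemma C1_bounded_grad:
  assumes "open S" "bounded S" "Ck_bar (Suc (Suc k)) S f" shows "C1_bounded S (grad f)"
  unfolding grad_eq_sum[abs_def]
  by (intro C1_bounded_sum C1_bounded_scaleR C1_bounded_const
      C1_bounded_frechet_derivative_Ck_bar[OF assms]) (simp_all add: axis_in_Basis_iff)

lemma C1_bounded_divergence:
  assumes "open S" "bounded S" "Ck_bar (Suc (Suc k)) S F" shows "C1_bounded S (divergence F)"
  unfolding divergence_eq_sum[abs_def]
  by (intro C1_bounded_sum C1_bounded_inner C1_bounded_const
      C1_bounded_frechet_derivative_Ck_bar[OF assms]) (simp_all add: axis_in_Basis_iff)

text \<open>Product rule for \<open>u \<bullet> u\<close>. Row \<open>i\<close> of the Jacobian is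
  the gradient of the \<open>i\<close>-th component, so \<open>u x\<close> multiplies it from the
  left.\<close>

lemma grad_norm_power2:
  assumes "u differentiable (at x)"
  shows "grad (\<lambda>y. (norm (u y))^2) x = 2 *\<^sub>R (u x v* jacobian u (at x))"
proof -
  note d = assms[unfolded frechet_derivative_works]
  have "((\<lambda>y. u y \<bullet> u y) has_derivative
      (\<lambda>h. u x \<bullet> frechet_derivative u (at x) h + frechet_derivative u (at x) h \<bullet> u x)) (at x)"
    by (rule has_derivative_inner[OF d d])
  then have "frechet_derivative (\<lambda>y. (norm (u y))^2) (at x) =
      (\<lambda>h. 2 * (u x \<bullet> frechet_derivative u (at x) h))"
    unfolding power2_norm_eq_inner
    by (subst frechet_derivative_at[symmetric]) (auto simp: inner_commute)
  then show ?thesis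
    by (simp add: grad_def vec_eq_iff jacobian_def matrix_def vector_matrix_mult_def inner_vec_def
        mult.commute)
qed

text \<open>Moving \<open>u x\<close> across the Jacobian produces half the gradient of the squared
  speed. This reduces the tested convective terms to fluxes paired with a scalar test
  function.\<close>

lemma advect_inner_self:
  assumes "u differentiable (at x)"
  shows "advect v u x \<bullet> u x = 1/2 * (v \<bullet> grad (\<lambda>y. (norm (u y))^2) x)"
  by (simp add: grad_norm_power2[OF assms] advect_def inner_commute[of v]
      inner_commute[of "_ *v _"] dot_lmul_matrix)

text \<open>A symmetric matrix pairs with the Jacobian as with its symmetric part, here half of
  Jacobian plus transpose. The viscous dissipation density is thus a weighted square.\<close>

lemma viscous_stress_inner_jacobian:
  "viscous_stress \<eta> u x \<bullet> jacobian u (at x)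
     = \<eta> x / 2 * (norm (jacobian u (at x) + transpose (jacobian u (at x))))^2"
proof -
  define A where "A = jacobian u (at x)"
  have 1: "transpose A \<bullet> transpose A = A \<bullet> A" and 2: "A \<bullet> transpose A = transpose A \<bullet> A"
    unfolding inner_vec_def transpose_def inner_real_def
    by (simp_all add: mult.commute) (rule sum.swap)
  show ?thesis
    unfolding viscous_stress_def A_def[symmetric] power2_norm_eq_inner
    by (simp add: inner_add_left inner_add_right 1 2 algebra_simps)
qed

subsection \<open>Semidefinite forms on vector families\<close>

text \<open>Expand the inner products in an orthonormal basis: for each basis vector
  \<open>b\<close> the coordinates \<open>w i \<bullet> b\<close> form one real vector, to which
  semidefiniteness applies; then sum over \<open>b\<close>.\<close>

lemma positive_semidefinite_sum_inner_nonneg: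
  fixes A :: "real^'m^'m::finite" and w :: "'m \<Rightarrow> 'a::euclidean_space"
  assumes "positive_semidefinite A"
  shows "0 \<le> (\<Sum>i\<in>UNIV. \<Sum>j\<in>UNIV. A $ i $ j * (w i \<bullet> w j))"
proof -
  have "(\<Sum>i\<in>UNIV. \<Sum>j\<in>UNIV. A $ i $ j * (w i \<bullet> w j))
      = (\<Sum>i\<in>UNIV. \<Sum>j\<in>UNIV. \<Sum>b\<in>Basis. (w i \<bullet> b) * (A $ i $ j * (w j \<bullet> b)))"
    by (simp add: euclidean_inner[of "w _" "w _"] sum_distrib_left mult_ac)
  also have "\<dots> = (\<Sum>i\<in>UNIV. \<Sum>b\<in>Basis. \<Sum>j\<in>UNIV. (w i \<bullet> b) * (A $ i $ j * (w j \<bullet> b)))"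
    by (intro sum.cong refl sum.swap)
  also have "\<dots> = (\<Sum>b\<in>Basis. \<Sum>i\<in>UNIV. \<Sum>j\<in>UNIV. (w i \<bullet> b) * (A $ i $ j * (w j \<bullet> b)))"
    by (rule sum.swap)
  also have "\<dots> = (\<Sum>b\<in>Basis. (\<chi> i. w i \<bullet> b) \<bullet> (A *v (\<chi> i. w i \<bullet> b)))"
    by (simp add: inner_vec_def matrix_vector_mult_def sum_distrib_left)
  also have "\<dots> \<ge> 0"
    using assms unfolding positive_semidefinite_def by (intro sum_nonneg) auto
  finally show ?thesis .
qed

text \<open>Convexity of the quadratic form: the difference of the two sides is half the form at
  \<open>w' - w\<close>.\<close>

lemma positive_semidefinite_quadratic_diff_le:
  fixes A :: "real^'m^'m::finite" and w w' :: "'m \<Rightarrow> 'a::euclidean_space"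
  assumes "positive_semidefinite A" and sym: "transpose A = A"
  shows "1/2 * (\<Sum>i\<in>UNIV. \<Sum>j\<in>UNIV. A $ i $ j * (w' i \<bullet> w' j))
      - 1/2 * (\<Sum>i\<in>UNIV. \<Sum>j\<in>UNIV. A $ i $ j * (w i \<bullet> w j))
      \<le> (\<Sum>i\<in>UNIV. \<Sum>j\<in>UNIV. (A $ i $ j *\<^sub>R w' j) \<bullet> (w' i - w i))"
proof -
  define B where "B v z = (\<Sum>i\<in>UNIV. \<Sum>j\<in>UNIV. A $ i $ j * (v i \<bullet> z j))" for v z :: "'m \<Rightarrow> 'a"
  have A: "A $ i $ j = A $ j $ i" for i j
    using arg_cong[OF sym, of "\<lambda>M. M $ j $ i"] by (simp add: transpose_def)
  \<comment> \<open>Symmetry of \<open>A\<close> makes the two mixed terms of the expanded square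
    equal.\<close>
  have comm: "B v z = B z v" for v z
    unfolding B_def by (subst sum.swap) (simp add: A inner_commute)
  have "0 \<le> B (\<lambda>i. w' i - w i) (\<lambda>i. w' i - w i)"
    unfolding B_def by (rule positive_semidefinite_sum_inner_nonneg[OF assms(1)])
  also have "\<dots> = B w' w' - B w' w - B w w' + B w w"
    unfolding B_def by (simp add: inner_diff_left inner_diff_right algebra_simps sum.distrib sum_subtractf)
  finally have "1/2 * B w' w' - 1/2 * B w w \<le> B w' w' - B w w'" using comm[of w' w] by simp
  also have "\<dots> = (\<Sum>i\<in>UNIV. \<Sum>j\<in>UNIV. (A $ i $ j *\<^sub>R w' j) \<bullet> (w' i - w i))"
    unfolding B_def by (simp add: inner_diff_right algebra_simps inner_commute sum_subtractf)
  finally show ?thesis unfolding B_def .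
qed

subsection \<open>Energy dissipation\<close>

theorem theorem3p1:
  fixes \<Omega> :: "(real^'d::finite) set"
    and p :: "'m::finite mixture"
    and c :: "real^'m^'m"
    and CT Mw Nt :: "'m \<Rightarrow> real"
    and k :: nat
    and dt root :: real
    and n \<mu> :: "nat \<Rightarrow> 'm \<Rightarrow> real^'d \<Rightarrow> real"
    and u :: "nat \<Rightarrow> real^'d \<Rightarrow> real^'d"
    and H :: "nat \<Rightarrow> real"
    and ustar :: "real^'d \<Rightarrow> real^'d"
    and J :: "'m \<Rightarrow> real^'d \<Rightarrow> real^'d"
    and Mob :: "real^'d \<Rightarrow> real^'m^'m"
    and \<eta> \<xi> lam :: "real^'d \<Rightarrow> real"
  assumes dim: "CARD('d) \<le> 3"
    and domain: "admissible_domain \<Omega>"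
    and mixture: "admissible_mixture p"
    and molar_weight: "\<And>i. Mw i > 0"
    and c_sym: "transpose c = c"
    and c_psd: "positive_semidefinite c"
    and CT_nonneg: "\<And>i. CT i \<ge> 0"
    and dt_pos: "dt > 0"
    and smooth_n: "\<And>i. Ck_bar 1 \<Omega> (n k i)" "\<And>i. Ck_bar 2 \<Omega> (n (Suc k) i)"
    and smooth_u: "Ck_bar 1 \<Omega> (u k)" "Ck_bar 2 \<Omega> (u (Suc k))"
    and smooth_ustar: "Ck_bar 1 \<Omega> ustar"
    and smooth_\<mu>: "\<And>i. Ck_bar 2 \<Omega> (\<mu> (Suc k) i)"
    and smooth_Mob: "\<And>i j. Ck_bar 1 \<Omega> (\<lambda>x. Mob x $ i $ j)"
    and smooth_visc: "Ck_bar 1 \<Omega> \<eta>" "Ck_bar 1 \<Omega> \<xi>"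
    and Mob_sym: "\<And>x. x \<in> \<Omega> \<Longrightarrow> transpose (Mob x) = Mob x"
    and Mob_psd: "\<And>x. x \<in> \<Omega> \<Longrightarrow> positive_semidefinite (Mob x)"
    and lam: "lam = (\<lambda>x. \<xi> x - 2/3 * \<eta> x)"
    and visc_pos: "\<And>x. x \<in> \<Omega> \<Longrightarrow> \<eta> x > 0" "\<And>x. x \<in> \<Omega> \<Longrightarrow> lam x > 0"
    and rho_pos: "\<And>x. x \<in> \<Omega> \<Longrightarrow> mass_density Mw (n k) x > 0"
    and n_domain: "\<And>x. x \<in> \<Omega> \<Longrightarrow> (\<lambda>i. n k i x) \<in> bulk_domain p"
    and bulk_integrable: "set_integrable lborel \<Omega> (\<lambda>x. bulk_density p (\<lambda>i. n k i x))"
      "\<And>i. set_integrable lborel \<Omega> (\<lambda>x. bulk_potential p i (\<lambda>j. n k j x))"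
    and Nt: "Nt = total_moles \<Omega> (n k)"
    and sav_pos: "bulk_energy p \<Omega> (n k) + (\<Sum>j\<in>UNIV. CT j * Nt j) > 0"
    and root: "root = sqrt (bulk_energy p \<Omega> (n k) + (\<Sum>j\<in>UNIV. CT j * Nt j))"
    and potential: "\<And>i x. x \<in> \<Omega> \<Longrightarrow>
      \<mu> (Suc k) i x = (H (Suc k) + H k) / (2 * root) * bulk_potential p i (\<lambda>j. n k j x)
        - (\<Sum>j\<in>UNIV. divergence (\<lambda>y. (c $ i $ j) *\<^sub>R grad (n (Suc k) j) y) x)"
    and auxiliary: "(H (Suc k) - H k) / dt =
      (\<Sum>i\<in>UNIV. LBINT x:\<Omega>. bulk_potential p i (\<lambda>j. n k j x) / (2 * root)
                               * ((n (Suc k) i x - n k i x) / dt))"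
    and intermediate: "\<And>x. x \<in> \<Omega> \<Longrightarrow>
      ustar x = u k x - (dt / mass_density Mw (n k) x) *\<^sub>R
                          (\<Sum>i\<in>UNIV. n k i x *\<^sub>R grad (\<mu> (Suc k) i) x)"
    and flux: "J = diffusion_flux Mob (\<mu> (Suc k))"
    and mass: "\<And>i x. x \<in> \<Omega> \<Longrightarrow>
      (n (Suc k) i x - n k i x) / dt + divergence (\<lambda>y. n k i y *\<^sub>R ustar y) x
        + divergence (J i) x = 0"
    and momentum: "\<And>x. x \<in> \<Omega> \<Longrightarrow>
      (mass_density Mw (n k) x / dt) *\<^sub>R (u (Suc k) x - u k x)
        + mass_density Mw (n k) x *\<^sub>R advect (ustar x) (u (Suc k)) x
        + (\<Sum>i\<in>UNIV. Mw i *\<^sub>R advect (J i x) (u (Suc k)) x)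
      = - (\<Sum>i\<in>UNIV. n k i x *\<^sub>R grad (\<mu> (Suc k) i) x)
        + grad (\<lambda>y. lam y * divergence (u (Suc k)) y) x
        + tensor_divergence (viscous_stress \<eta> (u (Suc k))) x"
    and parts_gradient: "\<And>i j \<phi>. \<phi> \<in> scalar_tests (n k) (n (Suc k)) (\<mu> (Suc k)) (u (Suc k)) \<Longrightarrow>
      flux_by_parts \<Omega> (\<lambda>y. (c $ i $ j) *\<^sub>R grad (n (Suc k) j) y) \<phi>"
    and parts_convective: "\<And>i \<phi>. \<phi> \<in> scalar_tests (n k) (n (Suc k)) (\<mu> (Suc k)) (u (Suc k)) \<Longrightarrow>
      flux_by_parts \<Omega> (\<lambda>y. n k i y *\<^sub>R ustar y) \<phi>"
    and parts_diffusive: "\<And>i \<phi>. \<phi> \<in> scalar_tests (n k) (n (Suc k)) (\<mu> (Suc k)) (u (Suc k)) \<Longrightarrow>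
      flux_by_parts \<Omega> (J i) \<phi>"
    and parts_viscous:
      "grad_by_parts \<Omega> (\<lambda>y. lam y * divergence (u (Suc k)) y) (u (Suc k))"
      "tensor_by_parts \<Omega> (viscous_stress \<eta> (u (Suc k))) (u (Suc k))"
  shows "kinetic_energy \<Omega> Mw (n (Suc k)) (u (Suc k))
           + modified_free_energy \<Omega> c CT Nt (n (Suc k)) (H (Suc k))
         \<le> kinetic_energy \<Omega> Mw (n k) (u k)
           + modified_free_energy \<Omega> c CT Nt (n k) (H k)"
proof -
  let ?I = "\<lambda>f::real^'d \<Rightarrow> real. LBINT x:\<Omega>. f x"
  let ?T = "scalar_tests (n k) (n (Suc k)) (\<mu> (Suc k)) (u (Suc k))"
  define n0 n1 m u0 u1 where "n0 = n k" and "n1 = n (Suc k)" and "m = \<mu> (Suc k)"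
    and "u0 = u k" and "u1 = u (Suc k)"
  note nm = n0_def[symmetric] n1_def[symmetric] m_def[symmetric] u0_def[symmetric] u1_def[symmetric]
  define H0 H1 where "H0 = H k" and "H1 = H (Suc k)"
  define rho0 rho1 where "rho0 = mass_density Mw n0" and "rho1 = mass_density Mw n1"
  define G where "G x = (\<Sum>i\<in>UNIV. n0 i x *\<^sub>R grad (m i) x)" for x
  define s where "s x = (norm (u1 x))^2" for x
  define D where "D i j = divergence (\<lambda>y. (c $ i $ j) *\<^sub>R grad (n1 j) y)" for i j
  define w where "w i x = n1 i x - n0 i x" for i x
  define C where "C i = (\<lambda>y. n0 i y *\<^sub>R ustar y)" for i
  define q where "q y = lam y * divergence u1 y" for y
  define V where "V x = grad q x + tensor_divergence (viscous_stress \<eta> u1) x" for x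

  \<comment> \<open>Regularity and integrability of the fields of the scheme\<close>
  have dom: "open \<Omega>" "bounded \<Omega>" using domain unfolding admissible_domain_def by auto
  then have meas: "\<Omega> \<in> sets lborel" by simp
  note cong = set_lebesgue_integral_cong[OF meas, rule_format]
  note integrable = bounded_cont_on_integrable[OF dom]

  \<comment> \<open>Orders 1 and 2 become successor terms, as the rules for \<open>Ck_bar\<close>
    require; at order 2 gradient and divergence are still of class C1.\<close>
  note suc = One_nat_def numeral_2_eq_2
  have C1_n0: "C1_bounded \<Omega> (n0 i)" and C1_n1: "C1_bounded \<Omega> (n1 i)"
    and C1_gn1: "C1_bounded \<Omega> (grad (n1 i))"
    and C1_m: "C1_bounded \<Omega> (m i)" and C1_gm: "C1_bounded \<Omega> (grad (m i))" for i
    using smooth_n(1)[of i, unfolded nm suc, THEN C1_bounded_Ck_bar[OF dom]]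
      smooth_n(2)[of i, unfolded nm suc, THEN C1_bounded_Ck_bar[OF dom]]
      smooth_n(2)[of i, unfolded nm suc, THEN C1_bounded_grad[OF dom]]
      smooth_\<mu>[of i, unfolded nm suc, THEN C1_bounded_Ck_bar[OF dom]]
      smooth_\<mu>[of i, unfolded nm suc, THEN C1_bounded_grad[OF dom]] .

  have C1_u0: "C1_bounded \<Omega> u0" and C1_us: "C1_bounded \<Omega> ustar" and C1_u1: "C1_bounded \<Omega> u1"
    and C1_du1: "C1_bounded \<Omega> (divergence u1)"
    using smooth_u(1)[unfolded nm suc, THEN C1_bounded_Ck_bar[OF dom]]
      smooth_ustar[unfolded suc, THEN C1_bounded_Ck_bar[OF dom]]
      smooth_u(2)[unfolded nm suc, THEN C1_bounded_Ck_bar[OF dom]]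
      smooth_u(2)[unfolded nm suc, THEN C1_bounded_divergence[OF dom]] .

  have C1_eta: "C1_bounded \<Omega> \<eta>" and C1_xi: "C1_bounded \<Omega> \<xi>"
    and C1_Mob: "C1_bounded \<Omega> (\<lambda>x. Mob x $ i $ j)" for i j
    using smooth_visc[unfolded suc, THEN C1_bounded_Ck_bar[OF dom]]
      smooth_Mob[of i j, unfolded suc, THEN C1_bounded_Ck_bar[OF dom]] .

  have C1_C: "C1_bounded \<Omega> (C i)" for i
    unfolding C_def by (intro C1_bounded_scaleR C1_n0 C1_us)
  have C1_cg: "C1_bounded \<Omega> (\<lambda>y. (c $ i $ j) *\<^sub>R grad (n1 j) y)" for i j
    by (intro C1_bounded_scaleR C1_bounded_const C1_gn1)
  have C1_s: "C1_bounded \<Omega> s"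
    unfolding s_def power2_norm_eq_inner by (intro C1_bounded_inner C1_u1)
  have lam': "lam = (\<lambda>x. \<xi> x + (- (2/3)) * \<eta> x)" by (simp add: lam)
  have C1_q: "C1_bounded \<Omega> q"
    unfolding q_def lam'
    by (intro C1_bounded_mult C1_bounded_add C1_bounded_const C1_eta C1_xi C1_du1)
  note bc = C1_boundedD(1)[OF C1_n0] C1_boundedD(1)[OF C1_n1] C1_boundedD(1)[OF C1_m]
    C1_boundedD(1)[OF C1_u0] C1_boundedD(1)[OF C1_us] C1_boundedD(1)[OF C1_u1]
    C1_boundedD(1)[OF C1_du1] C1_boundedD(1)[OF C1_Mob] C1_boundedD(1)[OF C1_s]
    C1_boundedD(1)[OF C1_gn1] C1_boundedD(1)[OF C1_gm]
    bounded_cont_on_grad[OF C1_n0] bounded_cont_on_grad[OF C1_s] bounded_cont_on_grad[OF C1_q]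
    bounded_cont_on_divergence[OF C1_C]
  have bc_rho: "bounded_cont_on \<Omega> rho0" "bounded_cont_on \<Omega> rho1"
    unfolding rho0_def rho1_def mass_density_def by (intro bounded_cont_on_intros bc)+
  have bc_w: "bounded_cont_on \<Omega> (w i)" for i
    unfolding w_def by (intro bounded_cont_on_intros bc)
  have bc_G: "bounded_cont_on \<Omega> G"
    unfolding G_def by (intro bounded_cont_on_intros bc)
  have bc_C: "bounded_cont_on \<Omega> (C i)" for i by (rule C1_boundedD(1)[OF C1_C])
  have bc_D: "bounded_cont_on \<Omega> (D i j)" for i j
    unfolding D_def by (rule bounded_cont_on_divergence[OF C1_cg])
  have J_eq: "J i = (\<lambda>x. \<Sum>j\<in>UNIV. ((-1) * Mob x $ i $ j) *\<^sub>R grad (m j) x)" for i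
    unfolding flux diffusion_flux_def[abs_def] nm by (simp add: sum_negf)
  have bc_J: "bounded_cont_on \<Omega> (J i)" for i
    unfolding J_eq by (intro bounded_cont_on_intros bc)
  \<comment> \<open>The mass balance solved for the divergence of \<open>J i\<close>: the right-hand
    side involves only fields of known regularity.\<close>
  have div_J: "divergence (J i) x = - (w i x / dt) - divergence (C i) x" if "x \<in> \<Omega>" for i x
    using mass[OF that, of i] unfolding nm w_def C_def by linarith
  have bc_divJ: "bounded_cont_on \<Omega> (divergence (J i))" for i
  proof -
    have "bounded_cont_on \<Omega> (\<lambda>x. (- 1 / dt) * w i x - divergence (C i) x)"
      by (intro bounded_cont_on_intros bc bc_w)
    then show ?thesis
      by (subst bounded_cont_on_cong[where g = "\<lambda>x. (- 1 / dt) * w i x - divergence (C i) x"])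
        (simp_all add: div_J)
  qed
  note bc' = bc bc_w bc_G bc_C bc_D bc_J bc_divJ bc_rho

  \<comment> \<open>The mass balance gives \<open>w i\<close> as \<open>- dt\<close> times the two
    divergences; membership of \<phi> in the test class allows both integrations by parts. It is
    used below for \<open>m i\<close> and for \<open>s\<close>.\<close>
  have mass_tested: "?I (\<lambda>x. w i x * \<phi> x) = dt * ?I (\<lambda>x. C i x \<bullet> grad \<phi> x) + dt * ?I (\<lambda>x. J i x \<bullet> grad \<phi> x)"
    if "\<phi> \<in> ?T" "bounded_cont_on \<Omega> \<phi>" for i \<phi>
  proof -
    have "?I (\<lambda>x. w i x * \<phi> x)
        = ?I (\<lambda>x. - dt * (divergence (C i) x * \<phi> x + divergence (J i) x * \<phi> x))"
      using dt_pos by (intro cong) (simp add: div_J field_simps)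
    also have "\<dots> = - dt * (?I (\<lambda>x. divergence (C i) x * \<phi> x) + ?I (\<lambda>x. divergence (J i) x * \<phi> x))"
      by (subst set_integral_mult_right, subst set_integral_add(2))
        (intro integrable bounded_cont_on_intros bc' that refl)+
    also have "\<dots> = dt * ?I (\<lambda>x. C i x \<bullet> grad \<phi> x) + dt * ?I (\<lambda>x. J i x \<bullet> grad \<phi> x)"
      using parts_convective[OF that(1), of i] parts_diffusive[OF that(1), of i]
      unfolding flux_by_parts_def nm C_def[symmetric] by (simp add: algebra_simps)
    finally show ?thesis .
  qed

  \<comment> \<open>Change of the modified free energy\<close>
  have free: "(H1\<^sup>2 - H0\<^sup>2)
      = (\<Sum>i\<in>UNIV. ?I (\<lambda>x. w i x * m i x)) + (\<Sum>i\<in>UNIV. \<Sum>j\<in>UNIV. ?I (\<lambda>x. D i j x * w i x))"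
  proof -
    \<comment> \<open>After multiplication by \<open>dt * (H1 + H0)\<close> the bulk potential
      carries exactly the factor \<open>(H1 + H0) / (2 * root)\<close> it has in the definition of
      \<open>m i\<close>, so it can be replaced by \<open>m i\<close> plus the terms
      \<open>D i j\<close>.\<close>
    have "?I (\<lambda>x. bulk_potential p i (\<lambda>j. n0 j x) / (2 * root) * (w i x / dt)) * (dt * (H1 + H0))
        = ?I (\<lambda>x. w i x * m i x) + (\<Sum>j\<in>UNIV. ?I (\<lambda>x. D i j x * w i x))" for i
    proof -
      have "?I (\<lambda>x. bulk_potential p i (\<lambda>j. n0 j x) / (2 * root) * (w i x / dt)) * (dt * (H1 + H0))
          = ?I (\<lambda>x. bulk_potential p i (\<lambda>j. n0 j x) / (2 * root) * (w i x / dt) * (dt * (H1 + H0)))"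
        by (rule set_integral_mult_left[symmetric])
      also have "\<dots> = ?I (\<lambda>x. w i x * m i x + (\<Sum>j\<in>UNIV. D i j x * w i x))"
      proof (intro cong)
        fix x assume "x \<in> \<Omega>"
        then have "m i x + (\<Sum>j\<in>UNIV. D i j x)
            = (H1 + H0) / (2 * root) * bulk_potential p i (\<lambda>j. n0 j x)"
          using potential[of x i] unfolding nm D_def H0_def H1_def by simp
        then have "(H1 + H0) / (2 * root) * bulk_potential p i (\<lambda>j. n0 j x) * w i x
            = w i x * m i x + (\<Sum>j\<in>UNIV. D i j x * w i x)"
          unfolding sum_distrib_right[symmetric]
          by (metis distrib_right mult.commute)
        then show "bulk_potential p i (\<lambda>j. n0 j x) / (2 * root) * (w i x / dt) * (dt * (H1 + H0))
            = w i x * m i x + (\<Sum>j\<in>UNIV. D i j x * w i x)"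
          using dt_pos by (simp add: mult_ac)
      qed
      also have "\<dots> = ?I (\<lambda>x. w i x * m i x) + (\<Sum>j\<in>UNIV. ?I (\<lambda>x. D i j x * w i x))"
        by (subst set_integral_add(2), (intro integrable bounded_cont_on_intros bc')+,
            subst set_integral_sum) (intro integrable bounded_cont_on_intros bc' refl)+
      finally show ?thesis .
    qed
    moreover have "H1\<^sup>2 - H0\<^sup>2 = (H1 - H0) / dt * (dt * (H1 + H0))"
      using dt_pos by (simp add: power2_eq_square field_simps)
    ultimately show ?thesis
      using auxiliary unfolding nm H0_def[symmetric] H1_def[symmetric] w_def[symmetric]
      by (simp only: sum_distrib_right sum.distrib)
  qed

  have gradient: "?I (\<lambda>x. D i j x * w i x)
      = - ?I (\<lambda>x. (c $ i $ j *\<^sub>R grad (n1 j) x) \<bullet> (grad (n1 i) x - grad (n0 i) x))" for i j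
  proof -
    \<comment> \<open>The test class contains the two densities but not their difference
      \<open>w i\<close>, so each is tested separately and the results are subtracted.\<close>
    have "n0 i \<in> ?T" "n1 i \<in> ?T" by (auto simp: scalar_tests_def nm)
    note parts = this[THEN parts_gradient[of _ i j], unfolded nm flux_by_parts_def, folded D_def]
    have "?I (\<lambda>x. D i j x * w i x) = ?I (\<lambda>x. D i j x * n1 i x) - ?I (\<lambda>x. D i j x * n0 i x)"
      unfolding w_def right_diff_distrib
      by (rule set_integral_diff(2)) (intro integrable bounded_cont_on_intros bc')+
    also have "\<dots> = - (?I (\<lambda>x. (c $ i $ j *\<^sub>R grad (n1 j) x) \<bullet> grad (n1 i) x)
        - ?I (\<lambda>x. (c $ i $ j *\<^sub>R grad (n1 j) x) \<bullet> grad (n0 i) x))"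
      using parts by simp
    also have "\<dots> = - ?I (\<lambda>x. (c $ i $ j *\<^sub>R grad (n1 j) x) \<bullet> (grad (n1 i) x - grad (n0 i) x))"
      unfolding inner_diff_right
      by (subst set_integral_diff(2)) (intro integrable bounded_cont_on_intros bc' refl)+
    finally show ?thesis .
  qed

  let ?Q = "\<lambda>v x. \<Sum>i\<in>UNIV. \<Sum>j\<in>UNIV. c $ i $ j * (grad (v i) x \<bullet> grad (v j) x)"
  let ?B = "\<lambda>x. \<Sum>i\<in>UNIV. \<Sum>j\<in>UNIV. (c $ i $ j *\<^sub>R grad (n1 j) x) \<bullet> (grad (n1 i) x - grad (n0 i) x)"
  have interface: "1/2 * ?I (?Q n1) - 1/2 * ?I (?Q n0) \<le> - (\<Sum>i\<in>UNIV. \<Sum>j\<in>UNIV. ?I (\<lambda>x. D i j x * w i x))"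
  proof -
    have Q: "set_integrable lborel \<Omega> (?Q n0)" "set_integrable lborel \<Omega> (?Q n1)" "set_integrable lborel \<Omega> ?B"
      by (intro integrable bounded_cont_on_intros bc')+
    have "1/2 * ?I (?Q n1) - 1/2 * ?I (?Q n0) = ?I (\<lambda>x. 1/2 * ?Q n1 x - 1/2 * ?Q n0 x)"
      using Q by (subst set_integral_diff(2)) auto
    \<comment> \<open>Convexity is applied pointwise to the gradients. The interface term of the
      potential is taken at the new level, the side on which the tangent bounds the increment from
      above.\<close>
    also have "\<dots> \<le> ?I ?B"
      using Q by (intro set_integral_mono positive_semidefinite_quadratic_diff_le c_sym c_psd) auto
    also have "\<dots> = (\<Sum>i\<in>UNIV. \<Sum>j\<in>UNIV.
        ?I (\<lambda>x. (c $ i $ j *\<^sub>R grad (n1 j) x) \<bullet> (grad (n1 i) x - grad (n0 i) x)))"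
      by (subst set_integral_sum, (intro integrable bounded_cont_on_intros bc')+, rule sum.cong[OF refl],
          subst set_integral_sum) (intro integrable bounded_cont_on_intros bc' refl)+
    finally show ?thesis by (simp add: gradient sum_negf)
  qed

  \<comment> \<open>Mass balance tested with the chemical potentials\<close>
  have mobility: "(\<Sum>i\<in>UNIV. J i x \<bullet> grad (m i) x) \<le> 0" if "x \<in> \<Omega>" for x
    \<comment> \<open>The minus sign in the diffusion flux turns the semidefinite form of the
      mobility into dissipation.\<close>
    using positive_semidefinite_sum_inner_nonneg[OF Mob_psd[OF that], of "\<lambda>i. grad (m i) x"]
    by (simp add: J_eq inner_commute[of "sum f A" for f A] inner_sum_right sum_negf)

  have diffusion: "(\<Sum>i\<in>UNIV. ?I (\<lambda>x. w i x * m i x)) \<le> dt * ?I (\<lambda>x. ustar x \<bullet> G x)"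
  proof -
    have T: "m i \<in> ?T" for i by (auto simp: scalar_tests_def nm)
    have "(\<Sum>i\<in>UNIV. ?I (\<lambda>x. w i x * m i x))
        = dt * (\<Sum>i\<in>UNIV. ?I (\<lambda>x. C i x \<bullet> grad (m i) x)) + dt * (\<Sum>i\<in>UNIV. ?I (\<lambda>x. J i x \<bullet> grad (m i) x))"
      using mass_tested[OF T] bc by (simp add: sum.distrib sum_distrib_left)
    also have "(\<Sum>i\<in>UNIV. ?I (\<lambda>x. C i x \<bullet> grad (m i) x)) = ?I (\<lambda>x. \<Sum>i\<in>UNIV. C i x \<bullet> grad (m i) x)"
      by (subst set_integral_sum) (intro integrable bounded_cont_on_intros bc' refl)+
    also have "(\<lambda>x. \<Sum>i\<in>UNIV. C i x \<bullet> grad (m i) x) = (\<lambda>x. ustar x \<bullet> G x)"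
      unfolding C_def G_def by (simp add: inner_sum_right)
    also have "(\<Sum>i\<in>UNIV. ?I (\<lambda>x. J i x \<bullet> grad (m i) x)) = ?I (\<lambda>x. \<Sum>i\<in>UNIV. J i x \<bullet> grad (m i) x)"
      by (subst set_integral_sum) (intro integrable bounded_cont_on_intros bc' refl)+
    also have "\<dots> \<le> 0"
      using set_integral_nonneg[of \<Omega> "\<lambda>x. - (\<Sum>i\<in>UNIV. J i x \<bullet> grad (m i) x)" lborel] mobility
      unfolding set_lebesgue_integral_def by simp
    finally show ?thesis using dt_pos by (simp add: mult_le_0_iff)
  qed

  have G_eq: "dt *\<^sub>R G x = rho0 x *\<^sub>R (u0 x - ustar x)" if "x \<in> \<Omega>" for x
    using intermediate[OF that] rho_pos[OF that]
    unfolding nm rho0_def[symmetric] G_def[symmetric] by (simp add: scaleR_right_diff_distrib)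

  have pressure: "dt * ?I (\<lambda>x. ustar x \<bullet> G x)
      \<le> 1/2 * ?I (\<lambda>x. rho0 x * (norm (u0 x))^2) - 1/2 * ?I (\<lambda>x. rho0 x * (norm (ustar x))^2)"
  proof -
    have "dt * ?I (\<lambda>x. ustar x \<bullet> G x) = ?I (\<lambda>x. dt * (ustar x \<bullet> G x))" by simp
    also have "\<dots> \<le> ?I (\<lambda>x. 1/2 * (rho0 x * (norm (u0 x))^2) - 1/2 * (rho0 x * (norm (ustar x))^2))"
    proof (rule set_integral_mono)
      fix x assume x: "x \<in> \<Omega>"
      have "dt * (ustar x \<bullet> G x) = rho0 x * (ustar x \<bullet> (u0 x - ustar x))"
        using G_eq[OF x] by (metis inner_scaleR_right)
      also have "ustar x \<bullet> (u0 x - ustar x)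
          = 1/2 * (norm (u0 x))^2 - 1/2 * (norm (ustar x))^2 - 1/2 * (norm (u0 x - ustar x))^2"
        unfolding power2_norm_eq_inner by (simp add: inner_diff_left inner_diff_right inner_commute field_simps)
      \<comment> \<open>The square of \<open>u0 x - ustar x\<close> is discarded; its weight
        \<open>rho0 x\<close> is positive.\<close>
      also have "rho0 x * \<dots> \<le> rho0 x * (1/2 * (norm (u0 x))^2 - 1/2 * (norm (ustar x))^2)"
        using rho_pos[OF x] unfolding nm rho0_def[symmetric] by (intro mult_left_mono) auto
      finally show "dt * (ustar x \<bullet> G x)
          \<le> 1/2 * (rho0 x * (norm (u0 x))^2) - 1/2 * (rho0 x * (norm (ustar x))^2)"
        by (simp add: algebra_simps)
    qed (intro integrable bounded_cont_on_intros bc')+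
    also have "\<dots> = 1/2 * ?I (\<lambda>x. rho0 x * (norm (u0 x))^2) - 1/2 * ?I (\<lambda>x. rho0 x * (norm (ustar x))^2)"
      by (subst set_integral_diff(2)) (simp; intro integrable bounded_cont_on_intros bc')+
    finally show ?thesis .
  qed

  \<comment> \<open>Momentum balance tested with the new velocity\<close>
  have momentum': "rho0 x *\<^sub>R (u1 x - ustar x) + dt *\<^sub>R (rho0 x *\<^sub>R advect (ustar x) u1 x)
      + dt *\<^sub>R (\<Sum>i\<in>UNIV. Mw i *\<^sub>R advect (J i x) u1 x) = dt *\<^sub>R V x" if "x \<in> \<Omega>" for x
  proof -
    have "(rho0 x / dt) *\<^sub>R (u1 x - u0 x) + rho0 x *\<^sub>R advect (ustar x) u1 x
        + (\<Sum>i\<in>UNIV. Mw i *\<^sub>R advect (J i x) u1 x) = - G x + V x"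
      using momentum[OF that] unfolding nm rho0_def[symmetric] G_def[symmetric] q_def[symmetric] V_def
      by (simp add: add.assoc)
    from arg_cong[OF this, of "\<lambda>v. dt *\<^sub>R v"] have
      "rho0 x *\<^sub>R (u1 x - u0 x) + dt *\<^sub>R (rho0 x *\<^sub>R advect (ustar x) u1 x)
        + dt *\<^sub>R (\<Sum>i\<in>UNIV. Mw i *\<^sub>R advect (J i x) u1 x) = - (dt *\<^sub>R G x) + dt *\<^sub>R V x"
      using dt_pos by (simp add: scaleR_right_distrib scaleR_right_diff_distrib)
    \<comment> \<open>Replacing \<open>dt *\<^sub>R G x\<close> shifts the reference velocity from
      \<open>u0\<close> to \<open>ustar\<close> and absorbs the force \<open>G\<close>.\<close>
    then show ?thesis by (simp add: G_eq[OF that] algebra_simps)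
  qed

  have energy_pointwise: "dt * (V x \<bullet> u1 x) = rho0 x * ((u1 x - ustar x) \<bullet> u1 x)
      + (\<Sum>i\<in>UNIV. (dt * Mw i / 2) * (C i x \<bullet> grad s x + J i x \<bullet> grad s x))" if "x \<in> \<Omega>" for x
  proof -
    have adv: "advect v u1 x \<bullet> u1 x = 1/2 * (v \<bullet> grad s x)" for v
      unfolding s_def using C1_boundedD(2)[OF C1_u1 that] by (rule advect_inner_self)
    \<comment> \<open>The convective mass flux is the sum of the molar fluxes \<open>C i\<close>
      weighted by molar weights, so together with \<open>J i\<close> it can be matched with the mass
      balance of each component.\<close>
    have C: "rho0 x * (ustar x \<bullet> grad s x) = (\<Sum>i\<in>UNIV. Mw i * (C i x \<bullet> grad s x))"
      unfolding rho0_def mass_density_def C_def by (simp add: sum_distrib_right mult.assoc)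
    have "dt * (V x \<bullet> u1 x) = (dt *\<^sub>R V x) \<bullet> u1 x" by simp
    also have "\<dots> = rho0 x * ((u1 x - ustar x) \<bullet> u1 x)
        + dt / 2 * (rho0 x * (ustar x \<bullet> grad s x)) + dt / 2 * (\<Sum>i\<in>UNIV. Mw i * (J i x \<bullet> grad s x))"
      unfolding momentum'[OF that, symmetric]
      by (simp add: inner_add_left inner_sum_left adv sum_distrib_left mult_ac)
    also have "\<dots> = rho0 x * ((u1 x - ustar x) \<bullet> u1 x)
      + (\<Sum>i\<in>UNIV. (dt * Mw i / 2) * (C i x \<bullet> grad s x + J i x \<bullet> grad s x))"
      unfolding C by (simp add: sum_distrib_left sum.distrib[symmetric] algebra_simps)
    finally show ?thesis .
  qed

  \<comment> \<open>The viscous work inherits its regularity from the tested momentum balance solved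
    for it.\<close>
  have bc_Vu: "bounded_cont_on \<Omega> (\<lambda>x. V x \<bullet> u1 x)"
  proof -
    have "bounded_cont_on \<Omega> (\<lambda>x. (1 / dt) * (rho0 x * ((u1 x - ustar x) \<bullet> u1 x)
      + (\<Sum>i\<in>UNIV. (dt * Mw i / 2) * (C i x \<bullet> grad s x + J i x \<bullet> grad s x))))"
      by (intro bounded_cont_on_intros bc')
    then show ?thesis
      by (rule bounded_cont_on_cong[THEN iffD1, rotated])
        (use dt_pos in \<open>simp only: energy_pointwise[symmetric], simp\<close>)
  qed

  have viscous: "?I (\<lambda>x. V x \<bullet> u1 x) \<le> 0"
  proof -
    let ?S = "viscous_stress \<eta> u1"
    \<comment> \<open>The stress term is written as a difference of two functions already known to
      be integrable, so that the integral splits.\<close>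
    have "?I (\<lambda>x. tensor_divergence ?S x \<bullet> u1 x) = ?I (\<lambda>x. V x \<bullet> u1 x - grad q x \<bullet> u1 x)"
      by (simp add: V_def inner_add_left)
    also have "\<dots> = ?I (\<lambda>x. V x \<bullet> u1 x) - ?I (\<lambda>x. grad q x \<bullet> u1 x)"
      by (rule set_integral_diff(2)) (intro integrable bounded_cont_on_intros bc' bc_Vu)+
    finally have "?I (\<lambda>x. V x \<bullet> u1 x) = - ?I (\<lambda>x. q x * divergence u1 x) - ?I (\<lambda>x. ?S x \<bullet> jacobian u1 (at x))"
      using parts_viscous unfolding nm q_def[symmetric] grad_by_parts_def tensor_by_parts_def by simp
    moreover have "0 \<le> ?I (\<lambda>x. q x * divergence u1 x)"
      unfolding q_def using visc_pos(2)
      by (intro set_integral_nonneg) (simp add: mult.assoc less_imp_le)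
    moreover have "0 \<le> ?I (\<lambda>x. ?S x \<bullet> jacobian u1 (at x))"
      unfolding viscous_stress_inner_jacobian using visc_pos(1)
      by (intro set_integral_nonneg) (simp add: less_imp_le)
    ultimately show ?thesis by linarith
  qed

  have kinetic: "1/2 * ?I (\<lambda>x. rho1 x * s x) \<le> 1/2 * ?I (\<lambda>x. rho0 x * (norm (ustar x))^2)"
  proof -
    have T: "s \<in> ?T" by (auto simp: scalar_tests_def nm s_def[abs_def])
    \<comment> \<open>Testing with \<open>s\<close> and weighting by \<open>Mw i / 2\<close> turns
      the convective terms into the change of mass density times half the squared speed.\<close>
    have "(\<Sum>i\<in>UNIV. (dt * Mw i / 2) * (?I (\<lambda>x. C i x \<bullet> grad s x) + ?I (\<lambda>x. J i x \<bullet> grad s x)))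
        = (\<Sum>i\<in>UNIV. Mw i / 2 * ?I (\<lambda>x. w i x * s x))"
      using mass_tested[OF T] bc by (intro sum.cong refl) (simp add: algebra_simps)
    also have "\<dots> = ?I (\<lambda>x. \<Sum>i\<in>UNIV. Mw i / 2 * (w i x * s x))"
      by (subst set_integral_sum) (intro integrable bounded_cont_on_intros bc' | simp)+
    also have "(\<lambda>x. \<Sum>i\<in>UNIV. Mw i / 2 * (w i x * s x)) = (\<lambda>x. 1/2 * ((rho1 x - rho0 x) * s x))"
      unfolding rho1_def rho0_def mass_density_def w_def
      by (simp add: fun_eq_iff sum_subtractf[symmetric] sum_distrib_right sum_distrib_left sum_divide_distrib algebra_simps)
    finally have conv: "(\<Sum>i\<in>UNIV. (dt * Mw i / 2) * (?I (\<lambda>x. C i x \<bullet> grad s x) + ?I (\<lambda>x. J i x \<bullet> grad s x)))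
        = ?I (\<lambda>x. 1/2 * ((rho1 x - rho0 x) * s x))" .
    have "dt * ?I (\<lambda>x. V x \<bullet> u1 x) = ?I (\<lambda>x. dt * (V x \<bullet> u1 x))" by simp
    also have "\<dots> = ?I (\<lambda>x. rho0 x * ((u1 x - ustar x) \<bullet> u1 x)
      + (\<Sum>i\<in>UNIV. (dt * Mw i / 2) * (C i x \<bullet> grad s x + J i x \<bullet> grad s x)))"
      by (intro cong energy_pointwise)
    also have "\<dots> = ?I (\<lambda>x. rho0 x * ((u1 x - ustar x) \<bullet> u1 x))
      + ?I (\<lambda>x. \<Sum>i\<in>UNIV. (dt * Mw i / 2) * (C i x \<bullet> grad s x + J i x \<bullet> grad s x))"
      by (rule set_integral_add(2)) (intro integrable bounded_cont_on_intros bc')+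
    also have "?I (\<lambda>x. \<Sum>i\<in>UNIV. (dt * Mw i / 2) * (C i x \<bullet> grad s x + J i x \<bullet> grad s x))
      = (\<Sum>i\<in>UNIV. (dt * Mw i / 2) * ?I (\<lambda>x. C i x \<bullet> grad s x + J i x \<bullet> grad s x))"
      by (subst set_integral_sum) (intro integrable bounded_cont_on_intros bc' | simp)+
    also have "\<dots> = (\<Sum>i\<in>UNIV. (dt * Mw i / 2) * (?I (\<lambda>x. C i x \<bullet> grad s x) + ?I (\<lambda>x. J i x \<bullet> grad s x)))"
      by (subst set_integral_add(2)) (intro integrable bounded_cont_on_intros bc' refl)+
    also note conv
    also have "?I (\<lambda>x. rho0 x * ((u1 x - ustar x) \<bullet> u1 x)) + ?I (\<lambda>x. 1/2 * ((rho1 x - rho0 x) * s x))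
      = ?I (\<lambda>x. rho0 x * ((u1 x - ustar x) \<bullet> u1 x) + 1/2 * ((rho1 x - rho0 x) * s x))"
      by (rule set_integral_add(2)[symmetric]) (intro integrable bounded_cont_on_intros bc')+
    \<comment> \<open>Polarization yields \<open>rho0 x * s x / 2\<close>, and the density increment
      upgrades \<open>rho0\<close> to \<open>rho1\<close>; the square of
      \<open>u1 x - ustar x\<close> is dropped.\<close>
    also have "\<dots> \<ge> ?I (\<lambda>x. 1/2 * (rho1 x * s x) - 1/2 * (rho0 x * (norm (ustar x))^2))"
    proof (rule set_integral_mono)
      fix x assume x: "x \<in> \<Omega>"
      have "(u1 x - ustar x) \<bullet> u1 x
          = 1/2 * s x - 1/2 * (norm (ustar x))^2 + 1/2 * (norm (u1 x - ustar x))^2"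
        unfolding power2_norm_eq_inner s_def
        by (simp add: inner_diff_left inner_diff_right inner_commute field_simps)
      then have "1/2 * s x - 1/2 * (norm (ustar x))^2 \<le> (u1 x - ustar x) \<bullet> u1 x" by simp
      then have "rho0 x * (1/2 * s x - 1/2 * (norm (ustar x))^2) \<le> rho0 x * ((u1 x - ustar x) \<bullet> u1 x)"
        using rho_pos[OF x] unfolding nm rho0_def[symmetric] by (intro mult_left_mono) auto
      then show "1/2 * (rho1 x * s x) - 1/2 * (rho0 x * (norm (ustar x))^2)
          \<le> rho0 x * ((u1 x - ustar x) \<bullet> u1 x) + 1/2 * ((rho1 x - rho0 x) * s x)"
        by (simp add: algebra_simps)
    qed (intro integrable bounded_cont_on_intros bc')+
    finally have "?I (\<lambda>x. 1/2 * (rho1 x * s x) - 1/2 * (rho0 x * (norm (ustar x))^2))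
        \<le> dt * ?I (\<lambda>x. V x \<bullet> u1 x)" .
    also have "\<dots> \<le> 0" using viscous dt_pos by (simp add: mult_le_0_iff)
    also have "?I (\<lambda>x. 1/2 * (rho1 x * s x) - 1/2 * (rho0 x * (norm (ustar x))^2))
        = 1/2 * ?I (\<lambda>x. rho1 x * s x) - 1/2 * ?I (\<lambda>x. rho0 x * (norm (ustar x))^2)"
      by (subst set_integral_diff(2)) (simp; intro integrable bounded_cont_on_intros bc')+
    finally show ?thesis by simp
  qed

  \<comment> \<open>On adding up, the integrals of \<open>D i j x * w i x\<close> cancel between
    \<open>free\<close> and \<open>interface\<close>, and the kinetic energy of \<open>ustar\<close>
    cancels between \<open>pressure\<close> and \<open>kinetic\<close>; the terms with
    \<open>CT\<close> agree on both sides.\<close>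
  show ?thesis
    using free interface diffusion pressure kinetic
    unfolding kinetic_energy_def modified_free_energy_def nm H0_def[symmetric] H1_def[symmetric]
      rho0_def[symmetric] rho1_def[symmetric] s_def power2_abs
    by linarith
qed

end
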